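(* Fix $\delta,\beta\in(0,1)$, $\eta>0$ and $K\ge1$. Let $R^{(1)},\ldots,R^{(K)}$ be i.i.d. with distribution $\mathbb{P}\in\mathcal{P}(\mathcal{X})$ and let $R^{(0)}$ be an independent random variable with distribution $\mathbb{P}_{\mathrm{test}}\in\mathcal{P}(\mathcal{X})$, where $$W_\infty(\mathbb{P},\mathbb{P}_{\mathrm{test}})\le\eta.$$ Let $\bar\alpha_{\mathrm{CP}}$ be any one of the following three estimators: (a) $\mathrm{Quantile}_{1-\delta+\sqrt{\ln(1/\beta)/(2K)}}(R^{(1)},\ldots,R^{(K)},\infty)$; (b) $\mathrm{Quantile}_{1-\delta'}(R^{(1)},\ldots,R^{(K)},\infty)$, where $\delta'\in[0,1]$ satisfies $\beta\ge I_{1-\delta}(K-\lfloor k\rfloor,\,1+\lfloor k\rfloor)$ with $k=\delta'(K+1)-1$; (c) $\mathrm{Quantile}_{1-\delta+\sqrt{2\delta\ln(1/\beta)/K}+2\ln(1/\beta)/K}(R^{(1)},\ldots,R^{(K)},\infty)$. Then $\bar\alpha_{\mathrm{CP}}^{\mathrm{test}}:=\bar\alpha_{\mathrm{CP}}+\eta$ satisfies $$\mathbb{P}^K\Bigl(\mathbb{P}_{\mathrm{test}}\bigl(R^{(0)}\le\bar\alpha_{\mathrm{CP}}^{\mathrm{test}}\bigr)\ge1-\delta\Bigr)\ge1-\beta,$$ where the inner probability is over $R^{(0)}\sim\mathbb{P}_{\mathrm{test}}$ with the calibration samples fixed and the outer one is over $R^{(1)},\ldots,R^{(K)}$.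
   Context: $\mathcal{X}\subseteq\mathbb{R}$ with its Borel $\sigma$-algebra, and $\mathcal{P}(\mathcal{X})$ is the set of Borel probability measures on $\mathcal{X}$. $\mathbb{P}^K=\mathbb{P}^{\otimes K}$. For values $a_1,\ldots,a_n\in\mathbb{R}\cup\{\infty\}$ and a level $p$, $\mathrm{Quantile}_p(a_1,\ldots,a_n)$ is the $\lceil np\rceil$-th smallest of them; for $\mathrm{Quantile}_{p}(R^{(1)},\ldots,R^{(K)},\infty)$ ($n=K+1$ values), whenever $p>K/(K+1)$ (including $p\ge1$) the value is $\infty$. $I_x(a,b)$ is the regularized incomplete beta function, i.e. the cumulative distribution function of a $\mathrm{Beta}(a,b)$ distribution evaluated at $x$, with the limiting conventions $I_x(a,0)=0$ and $I_x(0,b)=1$ for $x\in(0,1)$ and $a,b>0$. $W_\infty(\mathbb{P}_1,\mathbb{P}_2):=\inf_{\pi\in\Gamma(\mathbb{P}_1,\mathbb{P}_2)}\sup_{(x_1,x_2)\in\operatorname{supp}(\pi)}|x_1-x_2|$, where $\Gamma(\mathbb{P}_1,\mathbb{P}_2)$ is the set of couplings of $\mathbb{P}_1$ and $\mathbb{P}_2$. *)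

theory Defs
  imports "HOL-Probability.Probability"
begin

abbreviation prob_measures :: "real set \<Rightarrow> real measure set" where
  "prob_measures X \<equiv> space (prob_algebra (restrict_space borel X))"

definition couplings :: "'a measure \<Rightarrow> 'b measure \<Rightarrow> ('a \<times> 'b) measure set" where
  "couplings P Q =
     {\<pi> \<in> space (prob_algebra (P \<Otimes>\<^sub>M Q)). distr \<pi> P fst = P \<and> distr \<pi> Q snd = Q}"

text \<open>The topological support, relative to the subspace topology of the underlying space.\<close>

definition msupport :: "'a::topological_space measure \<Rightarrow> 'a set" where
  "msupport M = {x \<in> space M. \<forall>U. open U \<and> x \<in> U \<longrightarrow> emeasure M (U \<inter> space M) > 0}"

definition W_infinity :: "real measure \<Rightarrow> real measure \<Rightarrow> ennreal" where
  "W_infinity P Q = (INF \<pi>\<in>couplings P Q. SUP z\<in>msupport \<pi>. ennreal \<bar>fst z - snd z\<bar>)"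

text \<open>The \<open>\<lceil>n p\<rceil>\<close>-th smallest of the \<open>n\<close> listed values, and \<open>\<infinity>\<close> if \<open>\<lceil>n p\<rceil> > n\<close>.
  Only levels \<open>p > 0\<close> are meaningful; for \<open>p \<le> 0\<close> the value is the smallest entry.\<close>

definition quantile :: "real \<Rightarrow> ereal list \<Rightarrow> ereal" where
  "quantile p xs =
     (let r = \<lceil>real (length xs) * p\<rceil>
      in if r > int (length xs) then \<infinity> else sort xs ! (nat r - 1))"

definition conformal_quantile :: "nat \<Rightarrow> real \<Rightarrow> (nat \<Rightarrow> real) \<Rightarrow> ereal" where
  "conformal_quantile K p R = quantile p (map (\<lambda>i. ereal (R i)) [1..<Suc K] @ [\<infinity>])"

definition beta_density :: "real \<Rightarrow> real \<Rightarrow> real \<Rightarrow> real" where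
  "beta_density a b t =
     (if 0 < t \<and> t < 1 then t powr (a - 1) * (1 - t) powr (b - 1) / Beta a b else 0)"

text \<open>The distribution function of \<open>Beta(a,b)\<close> at \<open>x\<close>, extended to the boundary parameters
  by its limits as \<open>b \<rightarrow> 0\<close> and as \<open>a \<rightarrow> 0\<close> for \<open>0 < x < 1\<close>.\<close>

definition reg_inc_beta :: "real \<Rightarrow> real \<Rightarrow> real \<Rightarrow> real" where
  "reg_inc_beta x a b =
     (if b = 0 then 0
      else if a = 0 then 1
      else cdf (density lborel (\<lambda>t. ennreal (beta_density a b t))) x)"

end

theory Submission
  imports Defs
begin

text \<open>
  The calibrated quantile fails to cover the test distribution only if too many calibration samples
  are small, and the number of small samples is binomial.

  In detail, let \<open>q\<close> be the \<open>(1 - \<delta>)\<close>-quantile of the test distribution. Test coverage at least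
  \<open>1 - \<delta>\<close> means that the estimator is at least \<open>c = q - \<eta>\<close>. A bound \<open>\<eta>\<close> on the infinity-Wasserstein
  distance says that \<open>P(r \<le> x)\<close> never exceeds the test probability of \<open>r \<le> x + \<eta>\<close>
  (\<open>W_infinity_le_shift\<close>), so a calibration sample lies strictly below \<open>c\<close> with probability at most
  \<open>1 - \<delta>\<close>. The estimator is an order statistic of some rank \<open>r\<close>, and it is below \<open>c\<close> exactly when at
  least \<open>r\<close> samples are (\<open>le_conformal_quantile_iff\<close>). The number of such samples is binomial
  (\<open>prob_card_ge_eq_binomial_tail\<close>), and binomial tails increase with the success probability
  (\<open>binomial_tail_mono\<close>). Hence the failure probability is at most the probability that a
  \<open>Bin(K, 1 - \<delta>)\<close> variable reaches \<open>r\<close> (\<open>conformal_quantile_robust_coverage\<close>).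

  It remains to see that each of the three levels makes this tail at most \<open>\<beta>\<close>. The first does so by
  Hoeffding's inequality, the third by a Chernoff bound in terms of the small failure probability
  \<open>\<delta>\<close> (\<open>binomial_tail_Chernoff\<close>). For the second, the tail equals the regularized incomplete beta
  function in the hypothesis (\<open>reg_inc_beta_eq_binomial_tail\<close>).
\<close>

section \<open>Binomial tails as functions of the success probability\<close>

lemma binomial_tail_eq_sum:
  assumes "0 \<le> s" "s \<le> 1"
  shows "measure_pmf.prob (binomial_pmf n s) {r..} =
           (\<Sum>i=r..n. real (n choose i) * s ^ i * (1 - s) ^ (n - i))"
proof -
  have "measure_pmf.prob (binomial_pmf n s) {r..}
      = measure_pmf.prob (binomial_pmf n s) ({r..} \<inter> set_pmf (binomial_pmf n s))"
    by (simp add: measure_Int_set_pmf)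
  also have "{r..} \<inter> set_pmf (binomial_pmf n s) = {r..n} \<inter> set_pmf (binomial_pmf n s)"
    using assms by (auto simp: set_pmf_binomial_eq split: if_splits)
  also have "measure_pmf.prob (binomial_pmf n s) \<dots> = measure_pmf.prob (binomial_pmf n s) {r..n}"
    by (simp add: measure_Int_set_pmf)
  finally show ?thesis using assms by (simp add: measure_measure_pmf_finite)
qed

text \<open>
  The derivative of the \<open>i\<close>-th term is \<open>g i - g (Suc i)\<close>, because
  \<open>(n - i) (n choose i) = (i + 1) (n choose (i + 1))\<close>; so the sum telescopes to the single term
  \<open>g r\<close>, which is the \<open>Beta(r, n - r + 1)\<close> density. This one formula gives both the monotonicity of
  the tail in the success probability and its identification with the incomplete beta function.
\<close>

lemma binomial_tail_has_derivative:
  assumes "1 \<le> r" "r \<le> n"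
  shows "((\<lambda>s::real. \<Sum>i=r..n. real (n choose i) * s ^ i * (1 - s) ^ (n - i)) has_real_derivative
           real r * real (n choose r) * x ^ (r - 1) * (1 - x) ^ (n - r)) (at x)"
proof -
  define g where "g i = real i * real (n choose i) * x ^ (i - 1) * (1 - x) ^ (n - i)" for i
  have absorb: "real (n - i) * real (n choose i) = real (Suc i) * real (n choose Suc i)" if "i \<le> n" for i
  proof -
    have "(n - i) * (n choose i) = Suc i * (n choose Suc i)"
      using that by (metis binomial_absorb_comp binomial_absorption mult.commute)
    then show ?thesis by (metis of_nat_mult)
  qed
  have "((\<lambda>s::real. \<Sum>i=r..n. real (n choose i) * s ^ i * (1 - s) ^ (n - i)) has_real_derivative
     (\<Sum>i=r..n. g i - g (Suc i))) (at x)"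
  proof (rule DERIV_sum)
    fix i assume i: "i \<in> {r..n}"
    have "((\<lambda>s::real. real (n choose i) * s ^ i * (1 - s) ^ (n - i)) has_real_derivative
       g i - (real (n - i) * real (n choose i)) * x ^ i * (1 - x) ^ (n - i - 1)) (at x)"
      unfolding g_def by (auto intro!: derivative_eq_intros simp: algebra_simps)
    also have "g i - (real (n - i) * real (n choose i)) * x ^ i * (1 - x) ^ (n - i - 1) = g i - g (Suc i)"
      using i by (subst absorb) (auto simp: g_def)
    finally show "((\<lambda>s::real. real (n choose i) * s ^ i * (1 - s) ^ (n - i)) has_real_derivative
       g i - g (Suc i)) (at x)" .
  qed
  also have "(\<Sum>i=r..n. g i - g (Suc i)) = g r - g (Suc n)"
    using sum_Suc_diff[of r n "\<lambda>i. - g i"] assms by simp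
  also have "\<dots> = g r" by (simp add: g_def)
  finally show ?thesis by (simp add: g_def)
qed

text \<open>
  Needed because the number of samples below the relevant threshold is binomial with an unknown
  success probability, of which only an upper bound is available.
\<close>

lemma binomial_tail_mono:
  assumes "0 \<le> s" "s \<le> t" "t \<le> 1"
  shows "measure_pmf.prob (binomial_pmf n s) {r..} \<le> measure_pmf.prob (binomial_pmf n t) {r..}"
proof -
  consider "r = 0" | "n < r" | "1 \<le> r" "r \<le> n" by linarith
  then show ?thesis
  proof cases
    case 1
    then have "{r..} = (UNIV :: nat set)" by auto
    then show ?thesis by simp
  next
    case 2 with assms show ?thesis by (simp add: binomial_tail_eq_sum)
  next
    case 3
    have "(\<Sum>i=r..n. real (n choose i) * s ^ i * (1 - s) ^ (n - i))
        \<le> (\<Sum>i=r..n. real (n choose i) * t ^ i * (1 - t) ^ (n - i))"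
    proof (rule DERIV_nonneg_imp_nondecreasing[OF \<open>s \<le> t\<close>])
      fix x assume "s \<le> x" "x \<le> t"
      with assms have "0 \<le> real r * real (n choose r) * x ^ (r - 1) * (1 - x) ^ (n - r)" by simp
      with binomial_tail_has_derivative[OF 3, of x]
      show "\<exists>y. ((\<lambda>s. \<Sum>i=r..n. real (n choose i) * s ^ i * (1 - s) ^ (n - i)) has_real_derivative y) (at x) \<and> 0 \<le> y"
        by blast
    qed
    with assms show ?thesis by (simp add: binomial_tail_eq_sum)
  qed
qed

lemma Beta_of_nat:
  assumes "1 \<le> r" "r \<le> n"
  shows "1 / Beta (real r) (real n - real r + 1) = real r * real (n choose r)"
proof -
  have G: "Gamma (1 + real m) = fact m" for m by (rule Gamma_fact)
  have "Gamma (real r) = fact (r - 1)" using G[of "r - 1"] assms by (simp add: of_nat_diff)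
  moreover have "Gamma (real n - real r + 1) = fact (n - r)"
    using G[of "n - r"] assms by (simp add: of_nat_diff algebra_simps)
  moreover have "Gamma (real r + (real n - real r + 1)) = fact n"
    using G[of n] by (simp add: algebra_simps)
  moreover have "fact r = real r * fact (r - 1)" using assms by (simp add: fact_reduce)
  ultimately show ?thesis
    using assms by (simp add: Beta_def binomial_fact field_simps)
qed

text \<open>
  Both sides vanish at \<open>0\<close> and have the same derivative on \<open>(0, 1)\<close>, so the fundamental theorem
  of calculus identifies them.
\<close>

lemma reg_inc_beta_eq_binomial_tail:
  assumes "1 \<le> r" "r \<le> n" "0 < u" "u < 1"
  shows "reg_inc_beta u (real r) (real n - real r + 1) = measure_pmf.prob (binomial_pmf n u) {r..}"
proof -
  define f where "f x = real r * real (n choose r) * x ^ (r - 1) * (1 - x) ^ (n - r)" for x :: real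
  define T where "T s = (\<Sum>i=r..n. real (n choose i) * s ^ i * (1 - s) ^ (n - i))" for s :: real
  have dens: "beta_density (real r) (real n - real r + 1) x = f x" if "0 < x" "x < 1" for x
  proof -
    have "x powr (real r - 1) = x ^ (r - 1)"
      using that assms powr_realpow[of x "r - 1"] by (simp add: of_nat_diff)
    moreover have "(1 - x) powr (real n - real r + 1 - 1) = (1 - x) ^ (n - r)"
      using that assms powr_realpow[of "1 - x" "n - r"] by (simp add: of_nat_diff)
    ultimately have "beta_density (real r) (real n - real r + 1) x
        = 1 / Beta (real r) (real n - real r + 1) * x ^ (r - 1) * (1 - x) ^ (n - r)"
      using that by (simp add: beta_density_def)
    then show ?thesis using Beta_of_nat assms by (simp add: f_def)
  qed
  have [measurable]: "(\<lambda>t. ennreal (beta_density (real r) (real n - real r + 1) t)) \<in> borel_measurable borel"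
    unfolding beta_density_def by measurable
  have "emeasure (density lborel (\<lambda>t. ennreal (beta_density (real r) (real n - real r + 1) t))) {..u}
      = (\<integral>\<^sup>+x. ennreal (beta_density (real r) (real n - real r + 1) x) * indicator {..u} x \<partial>lborel)"
    by (subst emeasure_density) auto
  also have "\<dots> = (\<integral>\<^sup>+x. ennreal (f x) * indicator {0..u} x \<partial>lborel)"
  proof (rule nn_integral_cong_AE)
    show "AE x in lborel. ennreal (beta_density (real r) (real n - real r + 1) x) * indicator {..u} x
        = ennreal (f x) * indicator {0..u} x"
      using AE_lborel_singleton[of 0]
    proof eventually_elim
      case (elim x)
      consider "x < 0" | "0 < x" "x \<le> u" | "u < x" using elim by linarith
      then show ?case
      proof cases
        case 1 then show ?thesis by (simp add: beta_density_def)
      next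
        case 2 with assms dens[of x] show ?thesis by simp
      qed simp
    qed
  qed
  also have "\<dots> = ennreal (T u - T 0)"
  proof (rule nn_integral_FTC_Icc)
    show "f \<in> borel_measurable borel" unfolding f_def by measurable
    show "\<And>x. x \<in> {0..u} \<Longrightarrow> (T has_real_derivative f x) (at x)"
      using binomial_tail_has_derivative[OF assms(1,2)] by (simp add: T_def[abs_def] f_def)
    show "\<And>x. x \<in> {0..u} \<Longrightarrow> 0 \<le> f x" using assms by (auto simp: f_def)
    show "0 \<le> u" using assms by simp
  qed
  also have "T 0 = 0" using assms by (auto simp: T_def intro!: sum.neutral)
  also have "T u - 0 = measure_pmf.prob (binomial_pmf n u) {r..}"
    using assms by (simp add: T_def binomial_tail_eq_sum)
  finally show ?thesis
    using assms by (simp add: reg_inc_beta_def cdf_def measure_def)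
qed

section \<open>Exponential bounds on binomial tails\<close>

lemma binomial_tail_Hoeffding:
  assumes "0 \<le> s" "s \<le> 1" "0 < n" "0 \<le> t" and r: "real n * s + t \<le> real r"
  shows "measure_pmf.prob (binomial_pmf n s) {r..} \<le> exp (- 2 * t\<^sup>2 / real n)"
proof -
  have "measure_pmf.prob (binomial_pmf n s) {r..}
      \<le> measure_pmf.prob (binomial_pmf n s) {x. real n * s + t \<le> real x}"
    using r by (intro measure_pmf.finite_measure_mono) auto
  also have "\<dots> \<le> exp (- 2 * t\<^sup>2 / real n)"
    using assms by (intro binomial_distribution.prob_ge) (auto simp: binomial_distribution_def)
  finally show ?thesis .
qed

lemma exp_minus_le_quadratic:
  assumes "0 \<le> (x::real)"
  shows "exp (- x) \<le> 1 - x + x\<^sup>2 / 2"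
proof -
  have "1 \<le> (1 - x + x\<^sup>2 / 2) * (1 + x + x\<^sup>2 / 2)"
    using assms by (simp add: algebra_simps power2_eq_square)
  also have "\<dots> \<le> (1 - x + x\<^sup>2 / 2) * exp x"
  proof (rule mult_left_mono[OF exp_lower_Taylor_quadratic[OF assms]])
    have "0 \<le> (1 - x)\<^sup>2 + 1" by simp
    then show "0 \<le> 1 - x + x\<^sup>2 / 2" by (simp add: power2_eq_square algebra_simps)
  qed
  finally show ?thesis by (simp add: exp_minus field_simps)
qed

text \<open>
  The bound depends on the failure probability \<open>d\<close> and so is sharper than Hoeffding's for small
  \<open>d\<close>. It is the exponential Markov inequality: the indicator of \<open>i \<ge> r\<close> is bounded by
  \<open>exp (\<theta> (i - r))\<close>, the sum over all \<open>i\<close> is evaluated by the binomial theorem, and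
  \<open>exp (- \<theta>) \<le> 1 - \<theta> + \<theta>\<^sup>2 / 2\<close> leaves a quadratic exponent in \<open>\<theta>\<close>.
\<close>

lemma binomial_tail_Chernoff:
  assumes "0 < d" "d \<le> 1" "0 < n" "0 \<le> t" and r: "real n * (1 - d) + t \<le> real r"
  shows "measure_pmf.prob (binomial_pmf n (1 - d)) {r..} \<le> exp (- (t\<^sup>2 / (2 * real n * d)))"
proof -
  (* the minimizer of the quadratic exponent n d (\<theta>^2 / 2) - \<theta> t *)
  define \<theta> where "\<theta> = t / (real n * d)"
  have \<theta>: "0 \<le> \<theta>" using assms by (simp add: \<theta>_def)
  have "measure_pmf.prob (binomial_pmf n (1 - d)) {r..}
      = (\<Sum>i=r..n. real (n choose i) * (1 - d) ^ i * d ^ (n - i))"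
    using assms by (simp add: binomial_tail_eq_sum)
  also have "\<dots> \<le> (\<Sum>i=r..n. real (n choose i) * (1 - d) ^ i * d ^ (n - i) * exp (\<theta> * (real i - real r)))"
  proof (rule sum_mono)
    fix i assume "i \<in> {r..n}"
    then have "1 \<le> exp (\<theta> * (real i - real r))" using \<theta> by simp
    moreover have "0 \<le> real (n choose i) * (1 - d) ^ i * d ^ (n - i)" using assms by simp
    ultimately show "real (n choose i) * (1 - d) ^ i * d ^ (n - i)
        \<le> real (n choose i) * (1 - d) ^ i * d ^ (n - i) * exp (\<theta> * (real i - real r))"
      using mult_left_mono by fastforce
  qed
  also have "\<dots> \<le> (\<Sum>i\<le>n. real (n choose i) * (1 - d) ^ i * d ^ (n - i) * exp (\<theta> * (real i - real r)))"
    using assms by (intro sum_mono2) auto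
  also have "\<dots> = exp (\<theta> * (real n - real r)) * (\<Sum>i\<le>n. real (n choose i) * (1 - d) ^ i * (d * exp (- \<theta>)) ^ (n - i))"
    unfolding sum_distrib_left
  proof (rule sum.cong[OF refl])
    fix i assume "i \<in> {..n}"
    then have "exp (\<theta> * (real i - real r)) = exp (\<theta> * (real n - real r)) * exp (- \<theta>) ^ (n - i)"
      by (simp add: exp_add[symmetric] exp_of_nat_mult[symmetric] of_nat_diff algebra_simps)
    then show "real (n choose i) * (1 - d) ^ i * d ^ (n - i) * exp (\<theta> * (real i - real r)) =
      exp (\<theta> * (real n - real r)) * (real (n choose i) * (1 - d) ^ i * (d * exp (- \<theta>)) ^ (n - i))"
      by (simp add: power_mult_distrib)
  qed
  also have "(\<Sum>i\<le>n. real (n choose i) * (1 - d) ^ i * (d * exp (- \<theta>)) ^ (n - i)) = (1 - d + d * exp (- \<theta>)) ^ n"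
    by (simp add: binomial_ring)
  also have "(1 - d + d * exp (- \<theta>)) ^ n \<le> exp (d * (\<theta>\<^sup>2 / 2 - \<theta>)) ^ n"
  proof (rule power_mono)
    have "1 - d + d * exp (- \<theta>) \<le> 1 - d + d * (1 - \<theta> + \<theta>\<^sup>2 / 2)"
      using exp_minus_le_quadratic[OF \<theta>] assms by simp
    also have "\<dots> = 1 + d * (\<theta>\<^sup>2 / 2 - \<theta>)" by (simp add: algebra_simps)
    also have "\<dots> \<le> exp (d * (\<theta>\<^sup>2 / 2 - \<theta>))" by (rule exp_ge_add_one_self)
    finally show "1 - d + d * exp (- \<theta>) \<le> exp (d * (\<theta>\<^sup>2 / 2 - \<theta>))" .
  qed (use assms in simp)
  also have "exp (d * (\<theta>\<^sup>2 / 2 - \<theta>)) ^ n = exp (real n * d * (\<theta>\<^sup>2 / 2 - \<theta>))"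
    by (simp add: exp_of_nat_mult[symmetric] mult.assoc)
  also have "exp (\<theta> * (real n - real r)) * \<dots> \<le> exp (\<theta> * (real n * d - t)) * exp (real n * d * (\<theta>\<^sup>2 / 2 - \<theta>))"
  proof -
    have "real n - real r \<le> real n * d - t" using r by (simp add: algebra_simps)
    then show ?thesis using \<theta> by (simp add: mult_left_mono)
  qed
  also have "\<dots> = exp (\<theta>\<^sup>2 * (real n * d) / 2 - \<theta> * t)"
    by (simp add: exp_add[symmetric] algebra_simps)
  also have "\<theta>\<^sup>2 * (real n * d) / 2 - \<theta> * t = - (t\<^sup>2 / (2 * real n * d))"
    using assms by (simp add: \<theta>_def power2_eq_square field_simps)
  finally show ?thesis by simp
qed

section \<open>The three choices of the level\<close>

text \<open>
  The rank refers to \<open>K + 1\<close> values while the tail bounds refer to \<open>K\<close> samples; for positive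
  levels this discrepancy only makes the rank larger.
\<close>

lemma level_times_le_rank:
  assumes "0 < p"
  shows "real K * p \<le> real (nat \<lceil>real (Suc K) * p\<rceil>)"
proof -
  have "real K * p \<le> real (Suc K) * p" using assms by (simp add: algebra_simps)
  also have "\<dots> \<le> real (nat \<lceil>real (Suc K) * p\<rceil>)" by (rule real_nat_ceiling_ge)
  finally show ?thesis .
qed

text \<open>
  With \<open>t = K sqrt (L / (2 K))\<close> the Hoeffding exponent \<open>2 t\<^sup>2 / K\<close> is exactly \<open>L\<close>.
\<close>

lemma Hoeffding_level_tail:
  assumes "0 < K" "0 < \<delta>" "\<delta> < 1" "0 \<le> L"
  defines "p \<equiv> 1 - \<delta> + sqrt (L / (2 * real K))"
  shows "measure_pmf.prob (binomial_pmf K (1 - \<delta>)) {nat \<lceil>real (Suc K) * p\<rceil>..} \<le> exp (- L)"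
proof -
  define t where "t = real K * sqrt (L / (2 * real K))"
  have nonneg: "0 \<le> sqrt (L / (2 * real K))" using assms by simp
  then have t: "0 \<le> t" by (simp add: t_def)
  have p: "0 < p" unfolding p_def using nonneg assms(3) by linarith
  have "real K * (1 - \<delta>) + t = real K * p" by (simp add: p_def t_def algebra_simps)
  then have "measure_pmf.prob (binomial_pmf K (1 - \<delta>)) {nat \<lceil>real (Suc K) * p\<rceil>..}
      \<le> exp (- 2 * t\<^sup>2 / real K)"
    using level_times_le_rank[OF p, of K] t assms by (intro binomial_tail_Hoeffding) simp_all
  also have "t\<^sup>2 = real K * L / 2"
    using assms by (simp add: t_def power_mult_distrib) (simp add: power2_eq_square)
  finally show ?thesis using assms by simp
qed

text \<open>
  With \<open>t = K sqrt (2 \<delta> L / K)\<close> the exponent \<open>t\<^sup>2 / (2 K \<delta>)\<close> is exactly \<open>L\<close>. Since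
  the summand \<open>2 L / K\<close> of the level is nonnegative, the rank is at least \<open>K (1 - \<delta>) + t\<close>.
\<close>

lemma Chernoff_level_tail:
  assumes "0 < K" "0 < \<delta>" "\<delta> < 1" "0 \<le> L"
  defines "p \<equiv> 1 - \<delta> + sqrt (2 * \<delta> * L / real K) + 2 * L / real K"
  shows "measure_pmf.prob (binomial_pmf K (1 - \<delta>)) {nat \<lceil>real (Suc K) * p\<rceil>..} \<le> exp (- L)"
proof -
  define t where "t = real K * sqrt (2 * \<delta> * L / real K)"
  have nonneg: "0 \<le> sqrt (2 * \<delta> * L / real K)" "0 \<le> 2 * L / real K" using assms by simp_all
  then have p: "0 < p" and t: "0 \<le> t" using assms by (simp_all add: p_def t_def add_pos_nonneg)
  have "real K * p = real K * (1 - \<delta>) + t + real K * (2 * L / real K)"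
    by (simp add: p_def t_def distrib_left)
  moreover have "0 \<le> real K * (2 * L / real K)" using nonneg(2) by (rule mult_nonneg_nonneg[rotated]) simp
  ultimately have "real K * (1 - \<delta>) + t \<le> real (nat \<lceil>real (Suc K) * p\<rceil>)"
    using level_times_le_rank[OF p, of K] by linarith
  then have "measure_pmf.prob (binomial_pmf K (1 - \<delta>)) {nat \<lceil>real (Suc K) * p\<rceil>..}
      \<le> exp (- (t\<^sup>2 / (2 * real K * \<delta>)))"
    using t assms by (intro binomial_tail_Chernoff) simp_all
  also have "t\<^sup>2 = 2 * real K * \<delta> * L"
    using assms by (simp add: t_def power_mult_distrib) (simp add: power2_eq_square)
  finally show ?thesis using assms by simp
qed

text \<open>
  The rank belonging to the level \<open>1 - \<delta>'\<close> is \<open>r = K - \<lfloor>k\<rfloor>\<close>, so for \<open>r \<le> K\<close> the hypothesis on the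
  incomplete beta function is literally a bound on the binomial tail from \<open>r\<close>. At the two boundary
  values of \<open>\<lfloor>k\<rfloor>\<close> the limiting conventions take over: \<open>\<lfloor>k\<rfloor> = K\<close> would give rank \<open>0\<close>, but then the
  incomplete beta function is \<open>1\<close>, which exceeds \<open>\<beta>\<close>; and \<open>\<lfloor>k\<rfloor> = -1\<close> gives \<open>r = K + 1\<close>, where
  the tail is empty.
\<close>

lemma beta_level_tail:
  assumes "0 < \<delta>" "\<delta> < 1" "0 < \<beta>" "\<beta> < 1" "0 \<le> \<delta>'" "\<delta>' \<le> 1"
    and k: "k = \<delta>' * (real K + 1) - 1"
    and \<beta>: "reg_inc_beta (1 - \<delta>) (real K - real_of_int \<lfloor>k\<rfloor>) (1 + real_of_int \<lfloor>k\<rfloor>) \<le> \<beta>"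
  shows "\<delta>' < 1"
    and "measure_pmf.prob (binomial_pmf K (1 - \<delta>)) {nat \<lceil>real (Suc K) * (1 - \<delta>')\<rceil>..} \<le> \<beta>"
proof -
  have "\<lfloor>k\<rfloor> \<noteq> int K"
  proof
    assume "\<lfloor>k\<rfloor> = int K"
    then show False using \<beta> \<open>\<beta> < 1\<close> by (simp add: reg_inc_beta_def)
  qed
  moreover have "k \<le> real K"
  proof -
    have "k + 1 = \<delta>' * (real K + 1)" by (simp add: k)
    also have "\<dots> \<le> 1 * (real K + 1)" using assms(6) by (intro mult_right_mono) simp_all
    finally show ?thesis by simp
  qed
  moreover have "-1 \<le> k" using assms by (simp add: k)
  ultimately have j: "-1 \<le> \<lfloor>k\<rfloor>" "\<lfloor>k\<rfloor> < int K" by linarith+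
  show "\<delta>' < 1"
  proof (rule ccontr)
    assume "\<not> \<delta>' < 1"
    with assms(6) have "\<delta>' = 1" by simp
    then have "k = real K" by (simp add: k)
    with j show False by simp
  qed
  define r where "r = nat (int K - \<lfloor>k\<rfloor>)"
  have r: "1 \<le> r" "real r = real K - real_of_int \<lfloor>k\<rfloor>" using j by (simp_all add: r_def)
  have "real (Suc K) * (1 - \<delta>') = real_of_int (int K) - k" by (simp add: k algebra_simps)
  then have "\<lceil>real (Suc K) * (1 - \<delta>')\<rceil> = int K - \<lfloor>k\<rfloor>" by linarith
  then have rank: "nat \<lceil>real (Suc K) * (1 - \<delta>')\<rceil> = r" unfolding r_def by (rule arg_cong)
  have "measure_pmf.prob (binomial_pmf K (1 - \<delta>)) {r..} \<le> \<beta>"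
  proof (cases "r \<le> K")
    case True
    have "real K - real r + 1 = 1 + real_of_int \<lfloor>k\<rfloor>" using r by simp
    then have "measure_pmf.prob (binomial_pmf K (1 - \<delta>)) {r..}
        = reg_inc_beta (1 - \<delta>) (real K - real_of_int \<lfloor>k\<rfloor>) (1 + real_of_int \<lfloor>k\<rfloor>)"
      using reg_inc_beta_eq_binomial_tail[OF r(1) True, of "1 - \<delta>"] assms(1,2)
      unfolding r(2) by (simp add: add.commute)
    with \<beta> show ?thesis by simp
  next
    case False
    with assms(1-3) show ?thesis by (simp add: binomial_tail_eq_sum)
  qed
  then show "measure_pmf.prob (binomial_pmf K (1 - \<delta>)) {nat \<lceil>real (Suc K) * (1 - \<delta>')\<rceil>..} \<le> \<beta>"
    unfolding rank .
qed

section \<open>Order statistics and counting\<close>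

lemma le_sort_nth_iff:
  fixes xs :: "'a::linorder list"
  assumes "m < length xs"
  shows "c \<le> sort xs ! m \<longleftrightarrow> length (filter (\<lambda>x. x < c) xs) \<le> m"
proof -
  define ys where "ys = sort xs"
  have ys: "sorted ys" "m < length ys" using assms by (auto simp: ys_def)
  have "length (filter (\<lambda>x. x < c) xs) = length (filter (\<lambda>x. x < c) ys)"
    unfolding ys_def by (metis mset_filter mset_sort size_mset)
  also have "\<dots> = card {i. i < length ys \<and> ys ! i < c}"
    by (rule length_filter_conv_card)
  finally have eq: "length (filter (\<lambda>x. x < c) xs) = card {i. i < length ys \<and> ys ! i < c}" .
  show ?thesis
  proof
    assume c: "c \<le> sort xs ! m"
    have "{i. i < length ys \<and> ys ! i < c} \<subseteq> {..<m}"
    proof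
      fix i assume i: "i \<in> {i. i < length ys \<and> ys ! i < c}"
      show "i \<in> {..<m}"
      proof (rule ccontr)
        assume "i \<notin> {..<m}"
        then have "ys ! m \<le> ys ! i" using ys i by (auto intro: sorted_nth_mono)
        with c have "c \<le> ys ! i" unfolding ys_def by (rule order_trans)
        with i show False by (simp add: leD)
      qed
    qed
    from card_mono[OF _ this] show "length (filter (\<lambda>x. x < c) xs) \<le> m" by (simp add: eq)
  next
    assume len: "length (filter (\<lambda>x. x < c) xs) \<le> m"
    show "c \<le> sort xs ! m"
    proof (rule ccontr)
      assume "\<not> c \<le> sort xs ! m"
      then have "{..m} \<subseteq> {i. i < length ys \<and> ys ! i < c}"
        using ys by (auto simp: ys_def intro: order_le_less_trans[OF sorted_nth_mono])
      from card_mono[OF _ this] len show False by (simp add: eq)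
    qed
  qed
qed

text \<open>
  The appended \<open>\<infinity>\<close> never lies below \<open>c\<close>, so only the samples count. Ranks above \<open>K\<close> need no
  exception: the quantile is then \<open>\<infinity>\<close>, and at most \<open>K\<close> samples can lie below \<open>c\<close>. Positivity of
  the level makes the rank at least \<open>1\<close>.
\<close>

lemma le_conformal_quantile_iff:
  assumes "0 < p"
  shows "ereal c \<le> conformal_quantile K p R \<longleftrightarrow>
           card {i\<in>{1..K}. R i < c} < nat \<lceil>real (Suc K) * p\<rceil>"
proof -
  define xs where "xs = map (\<lambda>i. ereal (R i)) [1..<Suc K] @ [\<infinity>]"
  define r where "r = nat \<lceil>real (Suc K) * p\<rceil>"
  have len: "length xs = Suc K" by (simp add: xs_def)
  have r: "1 \<le> r" "\<lceil>real (Suc K) * p\<rceil> = int r"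
  proof -
    have "0 < real (Suc K) * p" using assms by simp
    then have "0 < \<lceil>real (Suc K) * p\<rceil>" by (simp only: zero_less_ceiling)
    then show "1 \<le> r" "\<lceil>real (Suc K) * p\<rceil> = int r" unfolding r_def by linarith+
  qed
  have "length (filter (\<lambda>x. x < ereal c) xs) = length (filter (\<lambda>i. R i < c) [1..<Suc K])"
    by (simp add: xs_def filter_map comp_def)
  also have "\<dots> = card (set (filter (\<lambda>i. R i < c) [1..<Suc K]))"
    by (rule distinct_card[symmetric]) simp
  also have "set (filter (\<lambda>i. R i < c) [1..<Suc K]) = {i\<in>{1..K}. R i < c}" by auto
  finally have count: "length (filter (\<lambda>x. x < ereal c) xs) = card {i\<in>{1..K}. R i < c}" .
  have cq: "conformal_quantile K p R = (if Suc K < r then \<infinity> else sort xs ! (r - 1))"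
    unfolding conformal_quantile_def quantile_def Let_def xs_def[symmetric] len r(2) by simp
  show ?thesis
  proof (cases "Suc K < r")
    case True
    have "card {i\<in>{1..K}. R i < c} \<le> card {1..K}" by (rule card_mono) auto
    with True show ?thesis unfolding cq r_def[symmetric] by simp
  next
    case False
    then have "ereal c \<le> sort xs ! (r - 1) \<longleftrightarrow> card {i\<in>{1..K}. R i < c} \<le> r - 1"
      using r(1) len count by (subst le_sort_nth_iff) auto
    then show ?thesis using False r(1) unfolding cq r_def[symmetric] by auto
  qed
qed

section \<open>Couplings and distribution functions\<close>

text \<open>
  The complement of the support is covered by the null sets of a countable base.
\<close>

lemma AE_msupport:
  fixes M :: "'a::second_countable_topology measure"
  assumes opens: "\<And>U. open U \<Longrightarrow> U \<inter> space M \<in> sets M"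
  shows "AE z in M. z \<in> msupport M"
proof -
  obtain B :: "'a set set" where B: "countable B" "topological_basis B"
    using ex_countable_basis by auto
  define N where "N = (\<Union>b\<in>{b\<in>B. b \<inter> space M \<in> null_sets M}. b \<inter> space M)"
  have "N \<in> null_sets M"
    unfolding N_def using B(1) by (intro null_sets_UN') auto
  moreover have "space M - msupport M \<subseteq> N"
  proof
    fix z assume z: "z \<in> space M - msupport M"
    then obtain U where U: "open U" "z \<in> U" "emeasure M (U \<inter> space M) = 0"
      by (auto simp: msupport_def)
    obtain b where b: "b \<in> B" "z \<in> b" "b \<subseteq> U"
      using topological_basisE[OF B(2) U(1,2)] by blast
    have null: "U \<inter> space M \<in> null_sets M" using U opens by auto
    have "b \<inter> space M \<in> null_sets M"
      using b opens topological_basis_open[OF B(2)] by (intro null_sets_subset[OF null]) auto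
    with b z show "z \<in> N" by (auto simp: N_def)
  qed
  ultimately show ?thesis by (intro AE_I'[of N]) auto
qed

text \<open>
  This makes the almost sure support property available for couplings, whose \<open>\<sigma>\<close>-algebra is a
  product of trace \<open>\<sigma>\<close>-algebras and not, a priori, a trace of the Borel sets of the product.
\<close>

lemma open_in_sets_pair_restrict_borel:
  fixes U :: "('a::second_countable_topology \<times> 'b::second_countable_topology) set"
  assumes "open U"
  shows "U \<inter> X \<times> Y \<in> sets (restrict_space borel X \<Otimes>\<^sub>M restrict_space borel Y)"
proof -
  have "(\<lambda>z. z) \<in> restrict_space borel X \<Otimes>\<^sub>M restrict_space borel Y \<rightarrow>\<^sub>M (borel \<Otimes>\<^sub>M borel)"
    by (rule measurable_pair) 
       (auto simp: comp_def intro!: measurable_compose[OF measurable_fst measurable_restrict_space1]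
          measurable_compose[OF measurable_snd measurable_restrict_space1])
  moreover have "U \<in> sets (borel \<Otimes>\<^sub>M borel)"
    using assms unfolding borel_prod by (rule borel_open)
  ultimately show ?thesis
    by (auto dest: measurable_sets simp: space_pair_measure space_restrict_space Int_commute)
qed

text \<open>
  Since \<open>X\<close> may be any set of reals, measures on it are related to Borel measures on the line
  through the inclusion of \<open>X\<close>.
\<close>

lemma prob_measures_id_measurable:
  assumes "P \<in> prob_measures X"
  shows "(\<lambda>x. x) \<in> borel_measurable P"
proof -
  have "sets P = sets (restrict_space borel X)" using assms by (simp add: space_prob_algebra)
  then have "measurable P borel = measurable (restrict_space borel X) (borel :: real measure)"
    by (rule measurable_cong_sets) simp
  then show ?thesis by (simp add: measurable_restrict_space1)
qed

text \<open>
  The strict inequality provides an actual coupling whose support, hence almost every of whose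
  points, satisfies \<open>\<bar>x - y\<bar> < e\<close>; on such points \<open>x \<le> a\<close> forces \<open>y \<le> a + e\<close>.
\<close>

lemma W_infinity_less_shift:
  assumes PX: "P \<in> prob_measures X" and QX: "Q \<in> prob_measures X"
    and W: "W_infinity P Q < ennreal e"
  shows "measure P {r \<in> space P. r \<le> a} \<le> measure Q {r \<in> space Q. r \<le> a + e}"
proof -
  have sP: "sets P = sets (restrict_space borel X)" and sQ: "sets Q = sets (restrict_space borel X)"
    using PX QX by (auto simp: space_prob_algebra)
  have spP: "space P = X" and spQ: "space Q = X"
    using sets_eq_imp_space_eq[OF sP] sets_eq_imp_space_eq[OF sQ] by (auto simp: space_restrict_space)
  have idP [measurable]: "(\<lambda>x. x) \<in> borel_measurable P" and idQ [measurable]: "(\<lambda>x. x) \<in> borel_measurable Q"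
    using PX QX by (simp_all only: prob_measures_id_measurable)
  obtain \<pi> where \<pi>: "\<pi> \<in> couplings P Q" and sup: "(SUP z\<in>msupport \<pi>. ennreal \<bar>fst z - snd z\<bar>) < ennreal e"
    using W by (auto simp: W_infinity_def INF_less_iff)
  from \<pi> have sets_\<pi> [measurable_cong]: "sets \<pi> = sets (P \<Otimes>\<^sub>M Q)" and "prob_space \<pi>"
    and fst: "distr \<pi> P fst = P" and snd: "distr \<pi> Q snd = Q"
    by (auto simp: couplings_def space_prob_algebra)
  interpret prob_space \<pi> by fact
  have sp: "space \<pi> = X \<times> X"
    using sets_eq_imp_space_eq[OF sets_\<pi>] by (simp add: space_pair_measure spP spQ)
  have sets': "sets \<pi> = sets (restrict_space borel X \<Otimes>\<^sub>M restrict_space borel X)"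
    using sets_\<pi> sets_pair_measure_cong[OF sP sQ] by simp
  have "AE z in \<pi>. z \<in> msupport \<pi>"
    by (rule AE_msupport) (simp add: sets' sp open_in_sets_pair_restrict_borel)
  then have close: "AE z in \<pi>. \<bar>fst z - snd z\<bar> < e"
  proof eventually_elim
    case (elim z)
    then have "ennreal \<bar>fst z - snd z\<bar> < ennreal e"
      using sup by (meson SUP_upper le_less_trans)
    then show ?case by (simp add: ennreal_less_iff)
  qed
  have "{r \<in> space P. r \<le> a} \<in> sets P" "{r \<in> space Q. r \<le> a + e} \<in> sets Q" by measurable
  note level_sets = this[unfolded spP spQ]
  have "measure P {r \<in> space P. r \<le> a} = measure (distr \<pi> P fst) {r \<in> space P. r \<le> a}"
    by (simp add: fst)
  also have "\<dots> = measure \<pi> {z \<in> space \<pi>. fst z \<le> a}"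
    by (subst measure_distr) (auto simp: sp spP level_sets intro!: arg_cong[where f="measure \<pi>"])
  also have "\<dots> \<le> measure \<pi> {z \<in> space \<pi>. snd z \<le> a + e}"
    using close by (intro finite_measure_mono_AE) auto
  also have "\<dots> = measure (distr \<pi> Q snd) {r \<in> space Q. r \<le> a + e}"
    by (subst measure_distr) (auto simp: sp spQ level_sets intro!: arg_cong[where f="measure \<pi>"])
  finally show ?thesis by (simp add: snd)
qed

lemma real_distribution_prob_measures:
  assumes "P \<in> prob_measures X"
  shows "real_distribution (distr P borel (\<lambda>x. x))"
proof (rule prob_space.real_distribution_distr[OF _ prob_measures_id_measurable[OF assms]])
  show "prob_space P" using assms by (simp add: space_prob_algebra)
qed

lemma cdf_prob_measures:
  assumes "P \<in> prob_measures X"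
  shows "cdf (distr P borel (\<lambda>x. x)) a = measure P {r \<in> space P. r \<le> a}"
proof -
  have "cdf (distr P borel (\<lambda>x. x)) a = measure P ((\<lambda>x. x) -` {..a} \<inter> space P)"
    unfolding cdf_def by (rule measure_distr[OF prob_measures_id_measurable[OF assms]]) simp
  also have "(\<lambda>x. x) -` {..a} \<inter> space P = {r \<in> space P. r \<le> a}" by auto
  finally show ?thesis .
qed

text \<open>
  The infimum over couplings need not be attained, so the previous lemma applies only to every
  \<open>y - a > e\<close>; right-continuity of the distribution function of \<open>Q\<close> then permits \<open>y\<close> to decrease
  to \<open>a + e\<close>.
\<close>

lemma W_infinity_le_shift:
  assumes PX: "P \<in> prob_measures X" and QX: "Q \<in> prob_measures X"
    and W: "W_infinity P Q \<le> ennreal e" and "0 \<le> e"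
  shows "measure P {r \<in> space P. r \<le> a} \<le> measure Q {r \<in> space Q. r \<le> a + e}"
proof -
  define F where "F = cdf (distr Q borel (\<lambda>x. x))"
  interpret real_distribution "distr Q borel (\<lambda>x. x)"
    by (rule real_distribution_prob_measures[OF QX])
  have "(F \<longlongrightarrow> F (a + e)) (at_right (a + e))"
    using cdf_is_right_cont[of "a + e"] by (simp add: F_def continuous_within)
  moreover have "eventually (\<lambda>y. measure P {r \<in> space P. r \<le> a} \<le> F y) (at_right (a + e))"
    using eventually_at_right_less[of "a + e"]
  proof eventually_elim
    case (elim y)
    then have "W_infinity P Q < ennreal (y - a)"
      using W \<open>0 \<le> e\<close> by (intro le_less_trans[OF W]) (simp add: ennreal_less_iff)
    from W_infinity_less_shift[OF PX QX this, of a] show ?case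
      by (simp add: F_def cdf_prob_measures[OF QX])
  qed
  ultimately have "measure P {r \<in> space P. r \<le> a} \<le> F (a + e)"
    by (rule tendsto_lowerbound) simp
  then show ?thesis by (simp add: F_def cdf_prob_measures[OF QX])
qed

lemma obtain_quantile:
  assumes QX: "Q \<in> prob_measures X" and "0 < u" "u < 1"
  obtains q where "\<And>x. u \<le> measure Q {r \<in> space Q. r \<le> x} \<longleftrightarrow> q \<le> x"
proof -
  interpret cdf_distribution "distr Q borel (\<lambda>x. x)"
    using real_distribution_prob_measures[OF QX] by (simp add: cdf_distribution_def)
  show ?thesis
    by (rule that, rule pseudoinverse[OF assms(2,3), unfolded cdf_prob_measures[OF QX]])
qed

lemma prob_less_le:
  assumes PX: "P \<in> prob_measures X"
    and below: "\<And>x. x < c \<Longrightarrow> measure P {r \<in> space P. r \<le> x} \<le> u"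
  shows "measure P {r \<in> space P. r < c} \<le> u"
proof -
  interpret real_distribution "distr P borel (\<lambda>x. x)"
    by (rule real_distribution_prob_measures[OF PX])
  have "measure (distr P borel (\<lambda>x. x)) {..<c} \<le> u"
  proof (rule tendsto_upperbound[OF cdf_at_left])
    show "eventually (\<lambda>x. cdf (distr P borel (\<lambda>x. x)) x \<le> u) (at_left c)"
      unfolding eventually_at_filter by (simp add: cdf_prob_measures[OF PX] below)
  qed simp
  also have "measure (distr P borel (\<lambda>x. x)) {..<c} = measure P {r \<in> space P. r < c}"
    using prob_measures_id_measurable[OF PX]
    by (auto simp: measure_distr intro!: arg_cong[where f="measure P"])
  finally show ?thesis .
qed

section \<open>Coverage under a distribution shift\<close>

text \<open>
  The event splits according to the exact set \<open>S\<close> of indices whose sample hits \<open>A\<close>. Each piece is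
  a product set, and there are \<open>card I choose j\<close> pieces with \<open>card S = j\<close>.
\<close>

lemma prob_card_ge_eq_binomial_tail:
  assumes "prob_space M" "finite I" and A: "A \<in> sets M"
  shows "measure (\<Pi>\<^sub>M i\<in>I. M) {x \<in> space (\<Pi>\<^sub>M i\<in>I. M). r \<le> card {i\<in>I. x i \<in> A}}
       = measure_pmf.prob (binomial_pmf (card I) (measure M A)) {r..}"
proof -
  interpret M: prob_space M by fact
  interpret product_prob_space "\<lambda>_. M" I by unfold_locales
  interpret finite_product_prob_space "\<lambda>_. M" I by unfold_locales fact
  define s where "s = measure M A"
  define n where "n = card I"
  define B where "B S = (\<Pi>\<^sub>E i\<in>I. if i \<in> S then A else space M - A)" for S
  define F where "F = {S. S \<subseteq> I \<and> r \<le> card S}"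
  have finF: "finite F" unfolding F_def using \<open>finite I\<close> by auto
  have AM: "A \<subseteq> space M" using A by (rule sets.sets_into_space)
  have s01: "0 \<le> s" "s \<le> 1" by (auto simp: s_def)
  have hits: "{i\<in>I. x i \<in> A} = S" if "x \<in> B S" "S \<subseteq> I" for x S
    using that by (auto simp: B_def PiE_iff split: if_splits)
  have event: "{x \<in> space (\<Pi>\<^sub>M i\<in>I. M). r \<le> card {i\<in>I. x i \<in> A}} = (\<Union>S\<in>F. B S)"
  proof (intro equalityI subsetI)
    fix x assume x: "x \<in> {x \<in> space (\<Pi>\<^sub>M i\<in>I. M). r \<le> card {i\<in>I. x i \<in> A}}"
    then have "x \<in> B {i\<in>I. x i \<in> A}"
      by (auto simp: B_def space_PiM PiE_iff)
    moreover have "{i\<in>I. x i \<in> A} \<in> F" using x by (auto simp: F_def)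
    ultimately show "x \<in> (\<Union>S\<in>F. B S)" by blast
  next
    fix x assume "x \<in> (\<Union>S\<in>F. B S)"
    then obtain S where S: "S \<subseteq> I" "r \<le> card S" "x \<in> B S" by (auto simp: F_def)
    from S(3) have "x \<in> space (\<Pi>\<^sub>M i\<in>I. M)"
      using AM by (auto simp: B_def space_PiM PiE_iff split: if_splits)
    with S hits[OF S(3,1)] show "x \<in> {x \<in> space (\<Pi>\<^sub>M i\<in>I. M). r \<le> card {i\<in>I. x i \<in> A}}"
      by simp
  qed
  have disj: "disjoint_family_on B F"
    unfolding disjoint_family_on_def F_def using hits by blast
  have meas: "B ` F \<subseteq> sets (\<Pi>\<^sub>M i\<in>I. M)"
    using A \<open>finite I\<close> unfolding B_def by (auto intro!: sets_PiM_I_finite)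
  have prob_B: "prob (B S) = s ^ card S * (1 - s) ^ (n - card S)" if "S \<subseteq> I" for S
  proof -
    have "prob (B S) = (\<Prod>i\<in>I. if i \<in> S then s else 1 - s)"
      unfolding B_def using A by (subst prob_times) (auto simp: s_def M.prob_compl intro!: prod.cong)
    also have "\<dots> = s ^ card (I \<inter> S) * (1 - s) ^ card (I \<inter> - S)"
      using \<open>finite I\<close> by (subst prod.If_cases) simp_all
    also have "I \<inter> S = S" using that by auto
    also have "I \<inter> - S = I - S" by auto
    finally show ?thesis
      using that \<open>finite I\<close> by (simp add: n_def card_Diff_subset finite_subset)
  qed
  have "prob (\<Union>S\<in>F. B S) = (\<Sum>S\<in>F. s ^ card S * (1 - s) ^ (n - card S))"
    by (subst finite_measure_finite_Union[OF finF meas disj]) (auto simp: prob_B F_def)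
  also have "\<dots> = (\<Sum>j=r..n. \<Sum>S\<in>{S\<in>F. card S = j}. s ^ card S * (1 - s) ^ (n - card S))"
    using finF \<open>finite I\<close> by (intro sum.group[symmetric]) (auto simp: F_def n_def intro: card_mono)
  also have "\<dots> = (\<Sum>j=r..n. real (n choose j) * s ^ j * (1 - s) ^ (n - j))"
  proof (rule sum.cong[OF refl])
    fix j assume j: "j \<in> {r..n}"
    then have "{S\<in>F. card S = j} = {S. S \<subseteq> I \<and> card S = j}" by (auto simp: F_def)
    then have "card {S\<in>F. card S = j} = n choose j"
      using n_subsets[OF \<open>finite I\<close>] by (simp add: n_def)
    then show "(\<Sum>S\<in>{S\<in>F. card S = j}. s ^ card S * (1 - s) ^ (n - card S)) =
        real (n choose j) * s ^ j * (1 - s) ^ (n - j)" by simp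
  qed
  also have "\<dots> = measure_pmf.prob (binomial_pmf n s) {r..}"
    using s01 by (simp add: binomial_tail_eq_sum)
  finally show ?thesis unfolding event n_def s_def .
qed

text \<open>
  Let \<open>q\<close> be the \<open>(1 - \<delta>)\<close>-quantile of \<open>Q\<close> and \<open>c = q - \<eta>\<close>. Coverage fails exactly when
  the conformal quantile is below \<open>c\<close>, that is, when at least as many samples as its rank fall below
  \<open>c\<close>. For \<open>x < c\<close> the shift inequality gives \<open>P(r \<le> x) \<le> Q(r \<le> x + \<eta>) < 1 - \<delta>\<close>, so a sample
  falls below \<open>c\<close> with probability at most \<open>1 - \<delta>\<close>. Working with the quantile of \<open>Q\<close> rather than
  that of \<open>P\<close> describes the coverage event exactly, which also yields its measurability.
\<close>

lemma conformal_quantile_robust_coverage: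
  assumes \<delta>: "0 < \<delta>" "\<delta> < 1" and "0 \<le> \<eta>" and p: "0 < p"
    and PX: "P \<in> prob_measures X" and QX: "Q \<in> prob_measures X"
    and W: "W_infinity P Q \<le> ennreal \<eta>"
    and tail: "measure_pmf.prob (binomial_pmf K (1 - \<delta>)) {nat \<lceil>real (Suc K) * p\<rceil>..} \<le> \<beta>"
  shows "1 - \<beta> \<le> measure (\<Pi>\<^sub>M i\<in>{1..K}. P)
           {R \<in> space (\<Pi>\<^sub>M i\<in>{1..K}. P).
              1 - \<delta> \<le> measure Q {r \<in> space Q. ereal r \<le> conformal_quantile K p R + ereal \<eta>}}"
proof -
  have "prob_space P" "prob_space Q" using PX QX by (auto simp: space_prob_algebra)
  interpret P: prob_space P by fact
  interpret Q: prob_space Q by fact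
  interpret samples: prob_space "\<Pi>\<^sub>M i\<in>{1..K}. P"
    by (intro prob_space_PiM P.prob_space_axioms)
  have [measurable]: "(\<lambda>x. x) \<in> borel_measurable P" by (rule prob_measures_id_measurable[OF PX])
  obtain q where q: "\<And>x. 1 - \<delta> \<le> measure Q {r \<in> space Q. r \<le> x} \<longleftrightarrow> q \<le> x"
    using obtain_quantile[OF QX, of "1 - \<delta>"] \<delta> by auto
  define c where "c = q - \<eta>"
  define A where "A = {x \<in> space P. x < c}"
  define m where "m = nat \<lceil>real (Suc K) * p\<rceil>"
  define bad where "bad = {R \<in> space (\<Pi>\<^sub>M i\<in>{1..K}. P). m \<le> card {i\<in>{1..K}. R i \<in> A}}"
  have A [measurable]: "A \<in> sets P" unfolding A_def by measurable
  have covers: "1 - \<delta> \<le> measure Q {r \<in> space Q. ereal r \<le> a + ereal \<eta>} \<longleftrightarrow> ereal c \<le> a" for a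
  proof (cases a)
    case (real x)
    have "q \<le> x + \<eta> \<longleftrightarrow> c \<le> x" by (auto simp: c_def)
    with q[of "x + \<eta>"] show ?thesis by (simp add: real)
  qed (use \<delta> in \<open>simp_all add: Q.prob_space\<close>)
  have good: "{R \<in> space (\<Pi>\<^sub>M i\<in>{1..K}. P).
      1 - \<delta> \<le> measure Q {r \<in> space Q. ereal r \<le> conformal_quantile K p R + ereal \<eta>}}
      = space (\<Pi>\<^sub>M i\<in>{1..K}. P) - bad"
  proof -
    have "ereal c \<le> conformal_quantile K p R \<longleftrightarrow> R \<notin> bad"
      if R: "R \<in> space (\<Pi>\<^sub>M i\<in>{1..K}. P)" for R
    proof -
      have "{i\<in>{1..K}. R i < c} = {i\<in>{1..K}. R i \<in> A}"
        using R by (auto simp: A_def space_PiM PiE_iff)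
      with R show ?thesis
        unfolding le_conformal_quantile_iff[OF p] m_def[symmetric] bad_def by (simp add: not_le)
    qed
    then show ?thesis unfolding covers by blast
  qed
  have "bad \<in> sets (\<Pi>\<^sub>M i\<in>{1..K}. P)"
  proof -
    have "card {i\<in>{1..K}. R i \<in> A} = (\<Sum>i\<in>{1..K}. if R i \<in> A then 1 else 0)" for R
      by (simp add: sum.If_cases Int_def)
    then have "bad = {R \<in> space (\<Pi>\<^sub>M i\<in>{1..K}. P). m \<le> (\<Sum>i\<in>{1..K}. if R i \<in> A then 1 else 0)}"
      unfolding bad_def by simp
    also have "\<dots> \<in> sets (\<Pi>\<^sub>M i\<in>{1..K}. P)" by measurable
    finally show ?thesis .
  qed
  moreover have "samples.prob bad \<le> \<beta>"
  proof -
    have "measure P A \<le> 1 - \<delta>"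
      unfolding A_def
    proof (rule prob_less_le[OF PX])
      fix x assume "x < c"
      then have "\<not> 1 - \<delta> \<le> measure Q {r \<in> space Q. r \<le> x + \<eta>}" by (simp add: q c_def)
      with W_infinity_le_shift[OF PX QX W \<open>0 \<le> \<eta>\<close>, of x]
      show "measure P {r \<in> space P. r \<le> x} \<le> 1 - \<delta>" by simp
    qed
    then have "measure_pmf.prob (binomial_pmf K (measure P A)) {m..}
        \<le> measure_pmf.prob (binomial_pmf K (1 - \<delta>)) {m..}"
      using \<delta> by (intro binomial_tail_mono) auto
    with tail show ?thesis
      using prob_card_ge_eq_binomial_tail[OF P.prob_space_axioms _ A, of "{1..K}" m]
      by (simp add: bad_def m_def)
  qed
  ultimately show ?thesis unfolding good by (simp only: samples.prob_compl)
qed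

theorem lemma5p2:
  fixes X :: "real set"
    and P P_test :: "real measure"
    and \<delta> \<beta> \<eta> :: real
    and K :: nat
    and \<alpha>_CP :: "(nat \<Rightarrow> real) \<Rightarrow> ereal"
  assumes "0 < \<delta>" "\<delta> < 1" "0 < \<beta>" "\<beta> < 1" "\<eta> > 0" "K \<ge> 1"
    and "P \<in> prob_measures X" "P_test \<in> prob_measures X"
    and "W_infinity P P_test \<le> ennreal \<eta>"
    and "\<alpha>_CP = conformal_quantile K (1 - \<delta> + sqrt (ln (1 / \<beta>) / (2 * real K)))
       \<or> (\<exists>\<delta>' k. 0 \<le> \<delta>' \<and> \<delta>' \<le> 1 \<and> k = \<delta>' * (real K + 1) - 1
             \<and> \<beta> \<ge> reg_inc_beta (1 - \<delta>) (real K - real_of_int \<lfloor>k\<rfloor>) (1 + real_of_int \<lfloor>k\<rfloor>)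
             \<and> \<alpha>_CP = conformal_quantile K (1 - \<delta>'))
       \<or> \<alpha>_CP = conformal_quantile K
             (1 - \<delta> + sqrt (2 * \<delta> * ln (1 / \<beta>) / real K) + 2 * ln (1 / \<beta>) / real K)"
  shows "measure (\<Pi>\<^sub>M i\<in>{1..K}. P)
           {R \<in> space (\<Pi>\<^sub>M i\<in>{1..K}. P).
              measure P_test {r \<in> space P_test. ereal r \<le> \<alpha>_CP R + ereal \<eta>} \<ge> 1 - \<delta>}
         \<ge> 1 - \<beta>"
proof -
  define L where "L = ln (1 / \<beta>)"
  have L: "0 < L" "exp (- L) = \<beta>" using assms(3,4) by (simp_all add: L_def ln_div)
  have K: "0 < K" using assms(6) by simp
  let ?tail = "\<lambda>p. measure_pmf.prob (binomial_pmf K (1 - \<delta>)) {nat \<lceil>real (Suc K) * p\<rceil>..}"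
  have "\<exists>p. \<alpha>_CP = conformal_quantile K p \<and> 0 < p \<and> ?tail p \<le> \<beta>"
    using assms(10)[folded L_def]
  proof (elim disjE exE conjE)
    let ?p = "1 - \<delta> + sqrt (L / (2 * real K))"
    assume "\<alpha>_CP = conformal_quantile K ?p"
    moreover have "?tail ?p \<le> \<beta>"
      using Hoeffding_level_tail[OF K assms(1,2), of L] L by simp
    moreover have "0 < ?p" using L K assms(2) by (intro add_pos_nonneg) simp_all
    ultimately show ?thesis by blast
  next
    fix \<delta>' k
    assume "0 \<le> \<delta>'" "\<delta>' \<le> 1" "k = \<delta>' * (real K + 1) - 1"
      "reg_inc_beta (1 - \<delta>) (real K - real_of_int \<lfloor>k\<rfloor>) (1 + real_of_int \<lfloor>k\<rfloor>) \<le> \<beta>"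
    note level = beta_level_tail[OF assms(1-4) this]
    assume "\<alpha>_CP = conformal_quantile K (1 - \<delta>')"
    moreover have "0 < 1 - \<delta>'" using level(1) by simp
    ultimately show ?thesis using level(2) by blast
  next
    let ?p = "1 - \<delta> + sqrt (2 * \<delta> * L / real K) + 2 * L / real K"
    assume "\<alpha>_CP = conformal_quantile K ?p"
    moreover have "?tail ?p \<le> \<beta>"
      using Chernoff_level_tail[OF K assms(1,2), of L] L by simp
    moreover have "0 < ?p" using L K assms(1,2) by (intro add_pos_nonneg) simp_all
    ultimately show ?thesis by blast
  qed
  then obtain p where p: "\<alpha>_CP = conformal_quantile K p" "0 < p" "?tail p \<le> \<beta>" by blast
  show ?thesis
    unfolding p(1)
    by (rule conformal_quantile_robust_coverage
          [OF assms(1,2) less_imp_le[OF assms(5)] p(2) assms(7-9) p(3)])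
qed

end
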